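(* Let $V:\mathcal H\to\mathbb R$ be differentiable with minimal value $V_*=\min_{\mathcal H}V$ and let $M>0$ be such that for all $x,y\in\mathcal H$ $$V(y)\le V(x)+\langle\nabla V(x),y-x\rangle_{\mathcal H}+\tfrac M2\|y-x\|_{\mathcal H}^2 .$$ Let $u_n=\Phi(\theta_n)$ be generated by the regularized parametric steepest descent method with stepsize $h>0$ and regularization parameters $\varepsilon_n>0$. (a) Under the stepsize restriction $hM\le 1/4$, a single step satisfies $$V(u_1)-V(u_0)\le-\tfrac12h\,\|\nabla V(u_0)\|_{\mathcal H}^2+\frac{5h}{4}\Bigl(\delta_0+\frac\beta2\,\frac{h\delta_0^2}{\varepsilon_0^2}\Bigr)^2,$$ where $\beta$ is a bound of the second derivative of $\Phi$ in a neighbourhood of $\theta_0$. (b) Under the additional stepsize restriction $h\delta_n\le c\,\varepsilon_n^2$ (for $n=0$), with a constant $c>0$, the step reduces the energy functional, $V(u_1)\le V(u_0)$, as long as $$\|\nabla V(u_0)\|_{\mathcal H}\ge\sqrt{2c_1}\;\delta_0\qquad\text{with}\quad c_1=\tfrac54\bigl(1+c\beta/2\bigr)^2 .$$ (c) If in addition the Polyak--Łojasiewicz inequality $\tfrac12\|\nabla V(y)\|_{\mathcal H}^2\ge\mu\,(V(y)-V_* )$ for all $y\in\mathcal H$ holds with some $\mu>0$, then under the stepsize restrictions $h\mu\le1$, $hM\le1/4$ and $h\delta_n\le c\,\varepsilon_n^2$ (for all steps $n$) we have $$V(u_n)-V_*\le(1-h\mu)^n\,(V(u_0)-V_* )+c_1h\sum_{j=1}^n(1-h\mu)^{j-1}\delta_{n-j}^2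 .$$
   Context: $\mathcal H$ is a Hilbert space (real; otherwise the real part of the inner product is used), $\mathcal Q$ a finite-dimensional inner product space, $\Phi:\mathcal Q\to\mathcal H$ twice continuously differentiable. $\nabla V:\mathcal H\to\mathcal H$ is the gradient with respect to the inner product of $\mathcal H$. Regularized parametric steepest descent: given $\theta_n$ and $u_n=\Phi(\theta_n)$, let $\dot\theta_n\in\mathcal Q$ be the unique minimizer such that $$\delta_n^2:=\|\Phi'(\theta_n)\dot\theta_n+\nabla V(u_n)\|_{\mathcal H}^2+\varepsilon_n^2\|\dot\theta_n\|_{\mathcal Q}^2\quad\text{is minimal},$$ and set $\theta_{n+1}=\theta_n+h\dot\theta_n$, $u_{n+1}=\Phi(\theta_{n+1})$. The bound $\beta$ on $\|\Phi''\|$ is understood to hold on the segment from $\theta_0$ to $\theta_1$ (and, in (c), on all segments from $\theta_n$ to $\theta_{n+1}$). *)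

theory Defs
  imports "HOL-Analysis.Analysis"
begin

definition rpsd_objective ::
    "('q::real_normed_vector \<Rightarrow>\<^sub>L 'h::real_inner) \<Rightarrow> 'h \<Rightarrow> real \<Rightarrow> 'q \<Rightarrow> real" where
  "rpsd_objective A g e v = (norm (blinfun_apply A v + g))\<^sup>2 + e\<^sup>2 * (norm v)\<^sup>2"

(* Regularized parametric steepest descent, as a relation between sequences. For e > 0 the objective is strictly convex,
   so the predicate is_arg_min determines dth n uniquely; on a finite-dimensional parameter
   space the minimizer exists. *)
definition rpsd_iteration ::
    "('q::real_normed_vector \<Rightarrow> 'h::real_inner) \<Rightarrow> ('q \<Rightarrow> 'q \<Rightarrow>\<^sub>L 'h) \<Rightarrow> ('h \<Rightarrow> 'h) \<Rightarrow> real \<Rightarrow>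
     (nat \<Rightarrow> real) \<Rightarrow> (nat \<Rightarrow> 'q) \<Rightarrow> (nat \<Rightarrow> 'q) \<Rightarrow> (nat \<Rightarrow> 'h) \<Rightarrow> bool" where
  "rpsd_iteration Phi dPhi gradV h eps th dth u \<longleftrightarrow>
     (\<forall>n. u n = Phi (th n) \<and>
          is_arg_min (rpsd_objective (dPhi (th n)) (gradV (u n)) (eps n)) (\<lambda>_. True) (dth n) \<and>
          th (Suc n) = th n + h *\<^sub>R dth n)"

end

theory Submission
  imports Defs
begin

text \<open>
  One step of the method is a perturbed gradient step: $u_1 - u_0 = h(e - \nabla V(u_0))$, where $e$ is the
  residual of the least squares problem plus $1/h$ times the second-order Taylor remainder of $\Phi$.
  The regularization gives $\varepsilon_0\|\dot\theta_0\| \le \delta_0$, hence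
  $\|e\| \le \delta_0 + \frac{\beta}{2} h\delta_0^2/\varepsilon_0^2$, and the quadratic upper bound on $V$
  turns this into the descent estimate (a); under $h\delta_n \le c\,\varepsilon_n^2$ the last factor is at
  most $(1 + c\beta/2)\,\delta_n$, which gives (b) and a linear recursion for (c).
\<close>

text \<open>Along the segment, the curve \<open>f (x + t k) - t f' x k\<close> has as its derivative
  the increment of \<open>f'\<close> applied to \<open>k\<close>, of norm at most
  \<open>B t (norm k)^2\<close> by the mean value inequality for \<open>f'\<close>. Comparing with a
  scalar majorant of this speed gives the factor 1/2 without integrals, so the codomain may be
  incomplete.\<close>

lemma taylor_remainder_norm_le:
  fixes f :: "'a::real_normed_vector \<Rightarrow> 'b::real_normed_vector"
    and f' :: "'a \<Rightarrow> 'a \<Rightarrow>\<^sub>L 'b"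
    and f'' :: "'a \<Rightarrow> 'a \<Rightarrow>\<^sub>L 'a \<Rightarrow>\<^sub>L 'b"
  assumes f': "\<And>p. p \<in> closed_segment x (x + k) \<Longrightarrow> (f has_derivative blinfun_apply (f' p)) (at p)"
    and f'': "\<And>p. p \<in> closed_segment x (x + k) \<Longrightarrow> (f' has_derivative blinfun_apply (f'' p)) (at p)"
    and bound: "\<And>p. p \<in> closed_segment x (x + k) \<Longrightarrow> norm (f'' p) \<le> B"
  shows "norm (f (x + k) - f x - f' x k) \<le> B / 2 * (norm k)\<^sup>2"
proof -
  have seg: "x + t *\<^sub>R k \<in> closed_segment x (x + k)" if "0 \<le> t" "t \<le> 1" for t
    using that by (auto simp: in_segment algebra_simps intro!: exI[of _ t])
  have lip: "norm (f' (x + t *\<^sub>R k) - f' x) \<le> B * (t * norm k)" if t: "0 \<le> t" "t \<le> 1" for t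
  proof -
    have "norm (f' (x + t *\<^sub>R k) - f' x) \<le> B * norm (x + t *\<^sub>R k - x)"
    proof (rule differentiable_bound[of "closed_segment x (x + k)" f' "\<lambda>p. blinfun_apply (f'' p)"])
      show "(f' has_derivative blinfun_apply (f'' p)) (at p within closed_segment x (x + k))"
        if "p \<in> closed_segment x (x + k)" for p
        using f''[OF that] by (rule has_derivative_at_withinI)
      show "onorm (blinfun_apply (f'' p)) \<le> B" if "p \<in> closed_segment x (x + k)" for p
        using bound[OF that] by (simp add: norm_blinfun.rep_eq)
    qed (use seg[OF t] in auto)
    then show ?thesis using t by simp
  qed
  define g where "g t = f (x + t *\<^sub>R k) - t *\<^sub>R f' x k" for t
  define g' where "g' t = f' (x + t *\<^sub>R k) k - f' x k" for t
  have g: "(g has_vector_derivative g' t) (at t)" if "0 \<le> t" "t \<le> 1" for t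
  proof -
    have "((\<lambda>s. f (x + s *\<^sub>R k)) has_derivative (\<lambda>s. f' (x + t *\<^sub>R k) (s *\<^sub>R k))) (at t)"
      by (rule has_derivative_compose[where f = "\<lambda>s. x + s *\<^sub>R k" and g = f, OF _ f'[OF seg[OF that]]])
        (auto intro!: derivative_eq_intros)
    then show ?thesis
      unfolding g_def g'_def has_vector_derivative_def
      by (auto intro!: derivative_eq_intros simp: algebra_simps blinfun.scaleR_right)
  qed
  \<comment> \<open>The majorant is \<open>B / 2 * (norm k)^2 * t^2\<close>. The factors
    \<open>1^2\<close> and \<open>0^2\<close> stay unsimplified to show the bound as a difference of
    its values at 1 and 0, the form in which the mean value inequality concludes.\<close>
  have "norm (g 1 - g 0) \<le> B / 2 * (norm k)\<^sup>2 * 1\<^sup>2 - B / 2 * (norm k)\<^sup>2 * 0\<^sup>2"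
  proof (rule differentiable_bound_general)
    show "continuous_on {0..1} g"
    proof (intro continuous_at_imp_continuous_on ballI)
      show "isCont g t" if "t \<in> {0..1}" for t
        using that by (intro has_vector_derivative_continuous[OF g]) auto
    qed
    show "continuous_on {0..1} (\<lambda>t. B / 2 * (norm k)\<^sup>2 * t\<^sup>2)"
      by (intro continuous_intros)
    show "(g has_vector_derivative g' t) (at t)" if "0 < t" "t < 1" for t
      using g that by simp
    show "((\<lambda>t. B / 2 * (norm k)\<^sup>2 * t\<^sup>2) has_vector_derivative B * (t * (norm k)\<^sup>2)) (at t)"
      for t :: real
      by (auto intro!: derivative_eq_intros simp: has_real_derivative_iff_has_vector_derivative[symmetric])
    show "norm (g' t) \<le> B * (t * (norm k)\<^sup>2)" if "0 < t" "t < 1" for t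
    proof -
      have "norm (g' t) \<le> norm (f' (x + t *\<^sub>R k) - f' x) * norm k"
        unfolding g'_def blinfun.diff_left[symmetric] by (rule norm_blinfun)
      also have "\<dots> \<le> B * (t * norm k) * norm k"
        using lip that by (intro mult_right_mono) auto
      finally show ?thesis by (simp add: power2_eq_square mult_ac)
    qed
  qed simp
  then show ?thesis by (simp add: g_def algebra_simps)
qed

text \<open>By polarization, \<open>inner g (e - g)\<close> is half of
  \<open>|e|^2 - |g|^2 - |e - g|^2\<close>. The stepsize restriction makes the quadratic term at
  most \<open>h / 8 * |e - g|^2\<close>, so the negative last square absorbs it.\<close>

lemma perturbed_gradient_step:
  fixes g e :: "'a::real_inner"
  assumes "M \<ge> 0" and "h \<ge> 0" and "h * M \<le> 1 / 4"
  shows "inner g (h *\<^sub>R (e - g)) + M / 2 * (norm (h *\<^sub>R (e - g)))\<^sup>2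
    \<le> - (1 / 2) * h * (norm g)\<^sup>2 + h / 2 * (norm e)\<^sup>2"
proof -
  have "M / 2 * (norm (h *\<^sub>R (e - g)))\<^sup>2 = h * M * (h / 2 * (norm (e - g))\<^sup>2)"
    by (simp add: power_mult_distrib power2_eq_square)
  also have "\<dots> \<le> 1 / 4 * (h / 2 * (norm (e - g))\<^sup>2)"
    using assms by (intro mult_right_mono) auto
  finally have "inner g (h *\<^sub>R (e - g)) + M / 2 * (norm (h *\<^sub>R (e - g)))\<^sup>2
      \<le> h * (inner g (e - g) + (norm (e - g))\<^sup>2 / 8)"
    by (simp add: algebra_simps)
  also have "\<dots> = - (1 / 2) * h * (norm g)\<^sup>2 + h / 2 * (norm e)\<^sup>2 - 3 / 8 * h * (norm (e - g))\<^sup>2"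
    by (simp add: power2_norm_eq_inner inner_diff inner_commute field_simps)
  also have "\<dots> \<le> - (1 / 2) * h * (norm g)\<^sup>2 + h / 2 * (norm e)\<^sup>2"
    using assms by simp
  finally show ?thesis .
qed

text \<open>Each summand of the objective is at most \<open>d^2\<close>: the first controls the
  residual, the second gives \<open>(norm v)^2 \<le> d^2 / e^2\<close> and thereby controls the
  Taylor remainder.\<close>

lemma parametric_descent_step:
  fixes V :: "'h::real_inner \<Rightarrow> real"
    and Phi :: "'q::real_normed_vector \<Rightarrow> 'h"
    and dPhi :: "'q \<Rightarrow> 'q \<Rightarrow>\<^sub>L 'h"
    and ddPhi :: "'q \<Rightarrow> 'q \<Rightarrow>\<^sub>L 'q \<Rightarrow>\<^sub>L 'h"
  assumes Phi': "\<And>p. (Phi has_derivative blinfun_apply (dPhi p)) (at p)"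
    and Phi'': "\<And>p. (dPhi has_derivative blinfun_apply (ddPhi p)) (at p)"
    and M_bound: "\<And>y. V y \<le> V (Phi x) + inner g (y - Phi x) + M / 2 * (norm (y - Phi x))\<^sup>2"
    and "M \<ge> 0" "h > 0" "e > 0" "h * M \<le> 1 / 4"
    and \<beta>: "\<And>p. p \<in> closed_segment x (x + h *\<^sub>R v) \<Longrightarrow> norm (ddPhi p) \<le> \<beta>"
    and d: "d = sqrt (rpsd_objective (dPhi x) g e v)"
  shows "V (Phi (x + h *\<^sub>R v)) - V (Phi x)
    \<le> - (1 / 2) * h * (norm g)\<^sup>2 + 5 * h / 4 * (d + \<beta> / 2 * (h * d\<^sup>2 / e\<^sup>2))\<^sup>2"
proof -
  define r where "r = Phi (x + h *\<^sub>R v) - Phi x - dPhi x (h *\<^sub>R v)"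
  \<comment> \<open>The perturbation of the exact gradient step. Dividing \<open>r\<close> by
    \<open>h\<close> is what makes the increment of \<open>Phi\<close> equal to
    \<open>h (w - g)\<close>.\<close>
  define w where "w = dPhi x v + g + (1 / h) *\<^sub>R r"
  have \<beta>0: "\<beta> \<ge> 0"
    by (rule order_trans[OF norm_ge_zero \<beta>[of x]]) simp
  have d2: "d\<^sup>2 = (norm (dPhi x v + g))\<^sup>2 + e\<^sup>2 * (norm v)\<^sup>2"
    unfolding d rpsd_objective_def by simp
  have d0: "d \<ge> 0"
    unfolding d rpsd_objective_def by simp
  have res: "norm (dPhi x v + g) \<le> d"
    by (rule power2_le_imp_le) (auto simp: d2 d0)
  have v: "(norm v)\<^sup>2 \<le> d\<^sup>2 / e\<^sup>2"
    using \<open>e > 0\<close> by (simp add: d2 field_simps)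
  have "norm r \<le> \<beta> / 2 * (norm (h *\<^sub>R v))\<^sup>2"
    unfolding r_def by (rule taylor_remainder_norm_le) (use Phi' Phi'' \<beta> in auto)
  also have "\<dots> = h * (\<beta> / 2 * (h * (norm v)\<^sup>2))"
    by (simp add: power_mult_distrib power2_eq_square)
  also have "\<dots> \<le> h * (\<beta> / 2 * (h * (d\<^sup>2 / e\<^sup>2)))"
    using v \<beta>0 \<open>h > 0\<close> by (intro mult_left_mono) auto
  finally have "norm ((1 / h) *\<^sub>R r) \<le> \<beta> / 2 * (h * d\<^sup>2 / e\<^sup>2)"
    using \<open>h > 0\<close> by (simp add: field_simps)
  with res have w: "norm w \<le> d + \<beta> / 2 * (h * d\<^sup>2 / e\<^sup>2)"
    unfolding w_def by (rule norm_triangle_mono)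
  have "Phi (x + h *\<^sub>R v) - Phi x = h *\<^sub>R (w - g)"
    using \<open>h > 0\<close> by (simp add: w_def r_def blinfun.scaleR_right algebra_simps)
  then have "V (Phi (x + h *\<^sub>R v)) - V (Phi x) \<le>
      inner g (h *\<^sub>R (w - g)) + M / 2 * (norm (h *\<^sub>R (w - g)))\<^sup>2"
    using M_bound[of "Phi (x + h *\<^sub>R v)"] by simp
  also have "\<dots> \<le> - (1 / 2) * h * (norm g)\<^sup>2 + h / 2 * (norm w)\<^sup>2"
    using assms by (intro perturbed_gradient_step) auto
  \<comment> \<open>The factor \<open>h / 2\<close> is relaxed here to the \<open>5 * h / 4\<close>
    of the claim.\<close>
  also have "\<dots> \<le> - (1 / 2) * h * (norm g)\<^sup>2 + 5 * h / 4 * (d + \<beta> / 2 * (h * d\<^sup>2 / e\<^sup>2))\<^sup>2"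
    using power_mono[OF w, of 2] \<open>h > 0\<close> by (intro add_left_mono mult_mono) auto
  finally show ?thesis .
qed

text \<open>The restriction bounds \<open>h d / e^2\<close> by \<open>c\<close>, so splitting one
  factor \<open>d\<close> off \<open>h d^2 / e^2\<close> makes the correction a multiple of
  \<open>d\<close>.\<close>

lemma perturbed_residual_le:
  fixes h d e c \<beta> :: real
  assumes "h > 0" "d \<ge> 0" "e > 0" "\<beta> \<ge> 0" "h * d \<le> c * e\<^sup>2"
  shows "5 * h / 4 * (d + \<beta> / 2 * (h * d\<^sup>2 / e\<^sup>2))\<^sup>2 \<le> 5 / 4 * (1 + c * \<beta> / 2)\<^sup>2 * h * d\<^sup>2"
proof -
  have "h * d / e\<^sup>2 \<le> c"
    using assms by (simp add: divide_le_eq)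
  then have "\<beta> / 2 * d * (h * d / e\<^sup>2) \<le> \<beta> / 2 * d * c"
    using assms by (intro mult_left_mono) auto
  then have "d + \<beta> / 2 * (h * d\<^sup>2 / e\<^sup>2) \<le> (1 + c * \<beta> / 2) * d"
    by (simp add: power2_eq_square algebra_simps)
  then have "(d + \<beta> / 2 * (h * d\<^sup>2 / e\<^sup>2))\<^sup>2 \<le> ((1 + c * \<beta> / 2) * d)\<^sup>2"
    using assms by (intro power_mono) auto
  then have "5 * h / 4 * (d + \<beta> / 2 * (h * d\<^sup>2 / e\<^sup>2))\<^sup>2 \<le> 5 * h / 4 * ((1 + c * \<beta> / 2) * d)\<^sup>2"
    using assms by (intro mult_left_mono) auto
  then show ?thesis by (simp add: power_mult_distrib mult_ac)
qed

text \<open>Discrete variation of constants: the defect \<open>b (n - j)\<close> enters in the step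
  from \<open>n - j\<close> to \<open>n - j + 1\<close> and is then multiplied by \<open>q\<close>
  in the remaining \<open>j - 1\<close> steps.\<close>

lemma linear_recursion_bound:
  fixes a b :: "nat \<Rightarrow> real"
  assumes "q \<ge> 0" and step: "\<And>n. a (Suc n) \<le> q * a n + C * b n"
  shows "a n \<le> q ^ n * a 0 + C * (\<Sum>j = 1..n. q ^ (j - 1) * b (n - j))"
proof (induction n)
  case 0
  then show ?case by simp
next
  case (Suc n)
  \<comment> \<open>The first term, \<open>j = 1\<close>, is the newest defect \<open>b n\<close>;
    shifting the index in the others releases a factor \<open>q\<close>. The deleted simp rules
    would split off the last term instead.\<close>
  have "(\<Sum>j = 1..Suc n. q ^ (j - 1) * b (Suc n - j))
      = b n + q * (\<Sum>j = 1..n. q ^ (j - 1) * b (n - j))"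
    by (simp add: sum.atLeast1_atMost_eq sum.lessThan_Suc_shift sum_distrib_left mult.assoc
        del: sum.lessThan_Suc sum.cl_ivl_Suc)
  then have "q ^ Suc n * a 0 + C * (\<Sum>j = 1..Suc n. q ^ (j - 1) * b (Suc n - j))
      = q * (q ^ n * a 0 + C * (\<Sum>j = 1..n. q ^ (j - 1) * b (n - j))) + C * b n"
    by (simp add: algebra_simps)
  then show ?case
    using step[of n] mult_left_mono[OF Suc.IH \<open>q \<ge> 0\<close>] by linarith
qed

theorem theorem8p1:
  fixes V :: "'h::{real_inner, complete_space} \<Rightarrow> real"
    and gradV :: "'h \<Rightarrow> 'h"
    and Phi :: "'q::real_inner \<Rightarrow> 'h"
    and dPhi :: "'q \<Rightarrow> 'q \<Rightarrow>\<^sub>L 'h"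
    and ddPhi :: "'q \<Rightarrow> 'q \<Rightarrow>\<^sub>L 'q \<Rightarrow>\<^sub>L 'h"
    and Vmin M h :: real
    and eps delta :: "nat \<Rightarrow> real"
    and th dth :: "nat \<Rightarrow> 'q"
    and u :: "nat \<Rightarrow> 'h"
  assumes findim: "\<exists>B::'q set. finite B \<and> span B = UNIV"
    and Phi': "\<And>p. (Phi has_derivative blinfun_apply (dPhi p)) (at p)"
    and Phi'': "\<And>p. (dPhi has_derivative blinfun_apply (ddPhi p)) (at p)"
    and Phi''_cont: "continuous_on UNIV ddPhi"
    and gradV: "\<And>x. GDERIV V x :> gradV x"
    and Vmin: "Vmin \<in> range V" "\<And>x. Vmin \<le> V x"
    and M_pos: "M > 0"
    and M_bound: "\<And>x y. V y \<le> V x + inner (gradV x) (y - x) + M / 2 * (norm (y - x))\<^sup>2"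
    and h_pos: "h > 0"
    and eps_pos: "\<And>n. eps n > 0"
    and iter: "rpsd_iteration Phi dPhi gradV h eps th dth u"
    and delta: "\<And>n. delta n = sqrt (rpsd_objective (dPhi (th n)) (gradV (u n)) (eps n) (dth n))"
  shows
    "(\<forall>\<beta>. h * M \<le> 1 / 4 \<longrightarrow>
        (\<forall>p \<in> closed_segment (th 0) (th 1). norm (ddPhi p) \<le> \<beta>) \<longrightarrow>
        V (u 1) - V (u 0) \<le> - (1 / 2) * h * (norm (gradV (u 0)))\<^sup>2
           + 5 * h / 4 * (delta 0 + \<beta> / 2 * (h * (delta 0)\<^sup>2 / (eps 0)\<^sup>2))\<^sup>2)
     \<and>
     (\<forall>\<beta> c. h * M \<le> 1 / 4 \<longrightarrow>
        (\<forall>p \<in> closed_segment (th 0) (th 1). norm (ddPhi p) \<le> \<beta>) \<longrightarrow>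
        c > 0 \<longrightarrow> h * delta 0 \<le> c * (eps 0)\<^sup>2 \<longrightarrow>
        (let c1 = 5 / 4 * (1 + c * \<beta> / 2)\<^sup>2 in
          norm (gradV (u 0)) \<ge> sqrt (2 * c1) * delta 0 \<longrightarrow> V (u 1) \<le> V (u 0)))
     \<and>
     (\<forall>\<beta> c \<mu>. h * M \<le> 1 / 4 \<longrightarrow>
        (\<forall>n. \<forall>p \<in> closed_segment (th n) (th (Suc n)). norm (ddPhi p) \<le> \<beta>) \<longrightarrow>
        c > 0 \<longrightarrow> (\<forall>n. h * delta n \<le> c * (eps n)\<^sup>2) \<longrightarrow>
        \<mu> > 0 \<longrightarrow> (\<forall>y. 1 / 2 * (norm (gradV y))\<^sup>2 \<ge> \<mu> * (V y - Vmin)) \<longrightarrow>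
        h * \<mu> \<le> 1 \<longrightarrow>
        (let c1 = 5 / 4 * (1 + c * \<beta> / 2)\<^sup>2 in
          \<forall>n. V (u n) - Vmin \<le> (1 - h * \<mu>) ^ n * (V (u 0) - Vmin)
             + c1 * h * (\<Sum>j = 1..n. (1 - h * \<mu>) ^ (j - 1) * (delta (n - j))\<^sup>2)))"
proof -
  have u: "u n = Phi (th n)" and th: "th (Suc n) = th n + h *\<^sub>R dth n" for n
    using iter unfolding rpsd_iteration_def by auto
  have step: "V (u (Suc n)) - V (u n) \<le> - (1 / 2) * h * (norm (gradV (u n)))\<^sup>2
      + 5 * h / 4 * (delta n + \<beta> / 2 * (h * (delta n)\<^sup>2 / (eps n)\<^sup>2))\<^sup>2"
    if "h * M \<le> 1 / 4" "\<forall>p \<in> closed_segment (th n) (th (Suc n)). norm (ddPhi p) \<le> \<beta>" for n \<beta>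
    unfolding u th
  proof (rule parametric_descent_step[OF Phi' Phi''])
    show "delta n = sqrt (rpsd_objective (dPhi (th n)) (gradV (Phi (th n))) (eps n) (dth n))"
      by (simp add: delta u)
  qed (use that M_bound M_pos h_pos eps_pos in \<open>auto simp: th\<close>)
  have step': "V (u (Suc n)) - V (u n) \<le> - (1 / 2) * h * (norm (gradV (u n)))\<^sup>2
      + 5 / 4 * (1 + c * \<beta> / 2)\<^sup>2 * h * (delta n)\<^sup>2"
    if "h * M \<le> 1 / 4" and \<beta>: "\<forall>p \<in> closed_segment (th n) (th (Suc n)). norm (ddPhi p) \<le> \<beta>"
      and c: "h * delta n \<le> c * (eps n)\<^sup>2" for n \<beta> c
  proof -
    \<comment> \<open>The sign of \<open>\<beta>\<close> is read off at the endpoint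
      \<open>th n\<close> of the segment.\<close>
    have "norm (ddPhi (th n)) \<le> \<beta>" using \<beta> by simp
    then have "\<beta> \<ge> 0" using norm_ge_zero order_trans by blast
    moreover have "delta n \<ge> 0" by (simp add: delta rpsd_objective_def)
    ultimately show ?thesis
      using step[OF that(1) \<beta>] perturbed_residual_le[OF h_pos _ eps_pos _ c, of \<beta>] by linarith
  qed
  show ?thesis
    unfolding Let_def
  proof (intro conjI allI impI)
    fix \<beta> :: real
    assume "h * M \<le> 1 / 4" "\<forall>p \<in> closed_segment (th 0) (th 1). norm (ddPhi p) \<le> \<beta>"
    then show "V (u 1) - V (u 0) \<le> - (1 / 2) * h * (norm (gradV (u 0)))\<^sup>2
        + 5 * h / 4 * (delta 0 + \<beta> / 2 * (h * (delta 0)\<^sup>2 / (eps 0)\<^sup>2))\<^sup>2"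
      using step[of 0 \<beta>] by simp
  next
    fix \<beta> c :: real
    let ?c1 = "5 / 4 * (1 + c * \<beta> / 2)\<^sup>2"
    assume *: "h * M \<le> 1 / 4" "\<forall>p \<in> closed_segment (th 0) (th 1). norm (ddPhi p) \<le> \<beta>"
      "h * delta 0 \<le> c * (eps 0)\<^sup>2"
      and grad: "norm (gradV (u 0)) \<ge> sqrt (2 * ?c1) * delta 0"
    \<comment> \<open>Nonnegativity of the smaller side permits squaring the gradient condition.
      Multiplied by \<open>h / 2\<close>, the squared condition says that the decrease outweighs the
      error term.\<close>
    have "0 \<le> sqrt (2 * ?c1) * delta 0" by (simp add: delta rpsd_objective_def)
    from power_mono[OF grad this, of 2] have "2 * ?c1 * (delta 0)\<^sup>2 \<le> (norm (gradV (u 0)))\<^sup>2"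
      by (simp add: power_mult_distrib)
    from mult_left_mono[OF this, of "h / 2"] h_pos
    have "?c1 * h * (delta 0)\<^sup>2 \<le> 1 / 2 * h * (norm (gradV (u 0)))\<^sup>2"
      by (simp add: mult_ac)
    moreover have "V (u 1) - V (u 0) \<le> - (1 / 2) * h * (norm (gradV (u 0)))\<^sup>2 + ?c1 * h * (delta 0)\<^sup>2"
      using step'[of 0 \<beta> c] * by simp
    ultimately show "V (u 1) \<le> V (u 0)" by linarith
  next
    fix \<beta> c \<mu> :: real
    let ?c1 = "5 / 4 * (1 + c * \<beta> / 2)\<^sup>2"
    assume hM: "h * M \<le> 1 / 4"
      and \<beta>: "\<forall>n. \<forall>p \<in> closed_segment (th n) (th (Suc n)). norm (ddPhi p) \<le> \<beta>"
      and c: "\<forall>n. h * delta n \<le> c * (eps n)\<^sup>2"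
      and PL: "\<forall>y. 1 / 2 * (norm (gradV y))\<^sup>2 \<ge> \<mu> * (V y - Vmin)"
      and h\<mu>: "h * \<mu> \<le> 1"
    show "V (u n) - Vmin \<le> (1 - h * \<mu>) ^ n * (V (u 0) - Vmin)
        + ?c1 * h * (\<Sum>j = 1..n. (1 - h * \<mu>) ^ (j - 1) * (delta (n - j))\<^sup>2)" for n
    \<comment> \<open>Here \<open>q = 1 - h * \<mu>\<close>, which is nonnegative by
      \<open>h * \<mu> \<le> 1\<close>, \<open>C = ?c1 * h\<close>, and the defects are the squares
      of \<open>delta\<close>.\<close>
    proof (rule linear_recursion_bound)
      show "V (u (Suc n)) - Vmin \<le> (1 - h * \<mu>) * (V (u n) - Vmin) + ?c1 * h * (delta n)\<^sup>2" for n
      proof -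
        \<comment> \<open>The Polyak-Lojasiewicz inequality turns the gradient decrease into a
          fraction \<open>h * \<mu>\<close> of the current energy gap, hence the contraction
          factor.\<close>
        have "h * (\<mu> * (V (u n) - Vmin)) \<le> h * (1 / 2 * (norm (gradV (u n)))\<^sup>2)"
          using PL h_pos by (intro mult_left_mono) auto
        moreover have "(1 - h * \<mu>) * (V (u n) - Vmin) = V (u n) - Vmin - h * (\<mu> * (V (u n) - Vmin))"
          by (simp add: algebra_simps)
        ultimately show ?thesis
          using step'[of n \<beta> c] hM \<beta> c by simp
      qed
    qed (use h\<mu> in simp)
  qed
qed

end
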